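(* Let $X$ be an infinite-dimensional complex Banach space. For $T\in\mathcal{B}(X)$, the following statements are equivalent: (i) $T$ is left Drazin invertible. (ii) $T^m$ is left Drazin invertible for all $m\in\mathbb{N}$. (iii) $T^m$ is left Drazin invertible for some $m\in\mathbb{N}$. Likewise, the following statements are equivalent: (i') $T$ is essentially left Drazin invertible. (ii') $T^m$ is essentially left Drazin invertible for all $m\in\mathbb{N}$. (iii') $T^m$ is essentially left Drazin invertible for some $m\in\mathbb{N}$.
   Context: $\mathcal{B}(X)$ is the algebra of bounded linear operators on $X$; $\mathcal{N}(T)$, $\mathcal{R}(T)$ denote kernel and range; $\mathbb{N}_0=\{0,1,2,\dots\}$, $\mathbb{N}=\{1,2,\dots\}$; the infimum of the empty set is $\infty$. A subspace of $X$ is topologically complemented if it is closed and has a closed algebraic complement in $X$. The ascent $a(T)$ is the smallest $n\in\mathbb{N}_0$ with $\mathcal{N}(T^n)=\mathcal{N}(T^{n+1})$, and the essential ascent $a_e(T)$ is the smallest $n\in\mathbb{N}_0$ with $\dim(\mathcal{N}(T)\cap\mathcal{R}(T^n))<\infty$ ($\infty$ if there is none). The degree of stable iteration is $\operatorname{dis}(T)=\inf\{n\in\mathbb{N}_0: m\ge n,\ m\in\mathbb{N}\Rightarrow \mathcal{N}(T)\cap\mathcal{R}(T^n)=\mathcal{N}(T)\cap\mathcal{R}(T^m)\}$. $T$ is left Drazin invertible if $p:=a(T)<\infty$ and $\mathcal{R}(T)+\mathcal{N}(T^p)$ is topologically complemented in $X$. $T$ is essentially left Drazin invertible if $a_e(T)<\infty$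 and $\mathcal{R}(T)+\mathcal{N}(T^{\operatorname{dis}(T)})$ is topologically complemented in $X$. *)

theory Defs
  imports "HOL-Analysis.Analysis" "HOL-Library.Extended_Nat" "HOL-Library.Set_Algebras"
begin

text \<open>
  The library provides normed and Banach spaces over the reals only.  A complex normed space is a
  real one with a scalar multiplication by complex numbers that extends the real one and for which
  the norm is absolutely homogeneous.
\<close>

class complex_normed_vector = real_normed_vector +
  fixes scaleC :: "complex \<Rightarrow> 'a \<Rightarrow> 'a"  (infixr "*\<^sub>C" 75)
  assumes scaleC_add_right: "a *\<^sub>C (x + y) = a *\<^sub>C x + a *\<^sub>C y"
    and scaleC_add_left: "(a + b) *\<^sub>C x = a *\<^sub>C x + b *\<^sub>C x"
    and scaleC_scaleC: "a *\<^sub>C (b *\<^sub>C x) = (a * b) *\<^sub>C x"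
    and scaleC_one: "1 *\<^sub>C x = x"
    and scaleR_scaleC: "r *\<^sub>R x = complex_of_real r *\<^sub>C x"
    and norm_scaleC: "norm (a *\<^sub>C x) = cmod a * norm x"

class complex_banach = complex_normed_vector + banach

instantiation complex :: complex_banach
begin

definition scaleC_complex :: "complex \<Rightarrow> complex \<Rightarrow> complex" where
  "scaleC_complex a x = a * x"

instance
  by standard (simp_all add: scaleC_complex_def algebra_simps norm_mult scaleR_conv_of_real)

end

global_interpretation complex_vector:
  vector_space "scaleC :: complex \<Rightarrow> 'a \<Rightarrow> 'a::complex_normed_vector"
  by standard (simp_all add: scaleC_add_right scaleC_add_left scaleC_scaleC scaleC_one)

definition finite_dim :: "'a::complex_normed_vector set \<Rightarrow> bool" where
  "finite_dim S \<longleftrightarrow> (\<exists>B. finite B \<and> complex_vector.span B = S)"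

definition bounded_clinear :: "('a::complex_normed_vector \<Rightarrow> 'a) \<Rightarrow> bool" where
  "bounded_clinear T \<longleftrightarrow>
     Vector_Spaces.linear scaleC scaleC T \<and> (\<exists>K. \<forall>x. norm (T x) \<le> K * norm x)"

definition topologically_complemented :: "'a::complex_normed_vector set \<Rightarrow> bool" where
  "topologically_complemented M \<longleftrightarrow>
     complex_vector.subspace M \<and> closed M \<and>
     (\<exists>N. complex_vector.subspace N \<and> closed N \<and> M \<inter> N = {0} \<and> M + N = UNIV)"

definition kernel :: "('a \<Rightarrow> 'a::zero) \<Rightarrow> 'a set" where
  "kernel T = {x. T x = 0}"

text \<open>
  In the next three definitions the infimum in \<^typ>\<open>enat\<close> of the empty set is \<open>\<infinity>\<close>, and that of a
  nonempty set is its least element.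
\<close>

definition ascent :: "('a \<Rightarrow> 'a::zero) \<Rightarrow> enat" where
  "ascent T = Inf {enat n |n. kernel (T ^^ n) = kernel (T ^^ (n + 1))}"

definition essential_ascent :: "('a \<Rightarrow> 'a::complex_normed_vector) \<Rightarrow> enat" where
  "essential_ascent T = Inf {enat n |n. finite_dim (kernel T \<inter> range (T ^^ n))}"

definition dis :: "('a \<Rightarrow> 'a::zero) \<Rightarrow> enat" where
  "dis T = Inf {enat n |n. \<forall>m\<ge>1. m \<ge> n \<longrightarrow>
     kernel T \<inter> range (T ^^ n) = kernel T \<inter> range (T ^^ m)}"

definition left_Drazin_invertible :: "('a \<Rightarrow> 'a::complex_normed_vector) \<Rightarrow> bool" where
  "left_Drazin_invertible T \<longleftrightarrow>
     (\<exists>p. ascent T = enat p \<and> topologically_complemented (range T + kernel (T ^^ p)))"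

text \<open>
  For linear \<open>T\<close>, finite essential ascent forces \<open>dis T < \<infinity>\<close>, because the subspaces
  \<open>kernel T \<inter> range (T ^^ n)\<close> decrease with \<open>n\<close> and are eventually finite-dimensional.  Hence
  requiring \<open>dis T\<close> to be a natural number \<open>d\<close> below is no additional condition.
\<close>

definition essentially_left_Drazin_invertible ::
    "('a \<Rightarrow> 'a::complex_normed_vector) \<Rightarrow> bool" where
  "essentially_left_Drazin_invertible T \<longleftrightarrow>
     essential_ascent T < \<infinity> \<and>
     (\<exists>d. dis T = enat d \<and> topologically_complemented (range T + kernel (T ^^ d)))"

end

theory Submission
  imports Defs
begin

text \<open>
  Fix \<open>n\<close> beyond the degree of stable iteration and put \<open>V j = range (T ^^ j) + kernel (T ^^ n)\<close>.  Left
  Drazin invertibility and its essential variant both ask that \<open>kernel T \<inter> range (T ^^ k)\<close> be eventually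
  small (zero, or finite-dimensional) and that \<open>V 1\<close> be topologically complemented, so everything rests on comparing \<open>V 1\<close> with \<open>V m\<close>.

  Stability of \<open>kernel T \<inter> range (T ^^ k)\<close> for \<open>k \<ge> n\<close> means that \<^emph>\<open>every\<close> \<open>kernel (T ^^ k)\<close> lies in every
  \<open>V j\<close> (\<open>kernel_pow_subset_range_ker\<close>).  Hence \<open>V j\<close> does not change when \<open>n\<close> grows, and
  \<open>(T ^^ i) x \<in> V (i + j)\<close> forces \<open>x \<in> V j\<close> (\<open>range_ker_cancel_pow\<close>): modulo these subspaces \<open>T\<close> is an
  injective shift \<open>X / V j \<rightarrow> V 1 / V (j + 1)\<close>.

  Going up, if \<open>N\<close> complements \<open>V 1\<close> and \<open>M\<close> complements \<open>V j\<close>, then \<open>(T ^^ j) ` N + M\<close> complements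
  \<open>V (j + 1)\<close>.  Going down, let \<open>M\<close> complement \<open>V (j + 1)\<close>.  For injective \<open>T\<close> (so \<open>n = 0\<close>) the
  preimage of \<open>M\<close> under \<open>T ^^ j\<close> complements \<open>range T\<close>; this is the remark that a left inverse \<open>S\<close> of
  \<open>T ^^ (j + 1)\<close> gives the left inverse \<open>S \<circ> T ^^ j\<close> of \<open>T\<close>.  In general one works modulo
  \<open>kernel (T ^^ n)\<close> and moves the resulting subspace into \<open>M\<close> along \<open>V (j + 1)\<close>, which yields a
  complement of \<open>V 1\<close>.

  All these complements are at first only algebraic.  They are topological because they, like the
  \<open>V j\<close>, are ranges of bounded operators on Banach spaces, and two such ranges with direct sum the
  whole space are both closed.  This is a consequence of the open mapping theorem
  (\<open>closed_images_if_direct_sum\<close>).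

  Finally, finiteness of the ascent and of the essential ascent passes between \<open>T\<close> and its powers;
  finite essential ascent implies stability, because a decreasing sequence of subspaces that reaches
  finite dimension is eventually constant; and a finite ascent equals \<open>dis T\<close>, so that left Drazin
  invertibility is the essential notion together with finite ascent.  Therefore each of the two
  properties holds for \<open>T\<close> if and only if it holds for any given power \<open>T ^^ m\<close> with \<open>m \<ge> 1\<close>.
\<close>

section \<open>Direct sums of operator ranges\<close>

text \<open>
  By Baire's theorem the closure of the image of some ball of \<open>S\<close> contains a ball \<open>cball y0 e\<close>.
  Differences of points of that closure then approximate every vector of norm \<open>e\<close>, and rescaling
  reaches every \<open>y\<close> with a constant independent of the accuracy \<open>d\<close>.
\<close>
lemma bounded_approximate_preimages:
  fixes f :: "'b::real_normed_vector \<Rightarrow> 'a::banach"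
  assumes "bounded_linear f" and S: "subspace S" and onto: "f ` S = UNIV"
  obtains C where "C \<ge> 0"
    and "\<And>y d. d > 0 \<Longrightarrow> \<exists>x\<in>S. norm x \<le> C * norm y \<and> norm (y - f x) < d"
proof -
  interpret f: bounded_linear f by fact
  define G where "G n = closure (f ` (S \<inter> cball 0 (real n)))" for n
  have "y \<in> \<Union> (range G)" for y
  proof -
    obtain x where x: "x \<in> S" "y = f x" using onto by blast
    obtain n where "norm x \<le> real n" using real_arch_simple by blast
    with x have "y \<in> G n"
      unfolding G_def by (intro subsetD[OF closure_subset]) auto
    then show ?thesis by blast
  qed
  then have "interior (\<Union> (range G)) \<noteq> {}"
    by (metis UNIV_I UNIV_eq_I empty_iff interior_UNIV)
  moreover have "interior (\<Union> (range G)) = {}" if "\<And>n. interior (G n) = {}"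
  proof -
    have "euclidean interior_of \<Union> (range G) = {}"
    proof (rule Baire_category_alt)
      show "completely_metrizable_space (euclidean :: 'a topology) \<or>
          locally_compact_space (euclidean :: 'a topology) \<and> regular_space (euclidean :: 'a topology)"
        using completely_metrizable_space_euclidean by blast
      show "closedin euclidean V \<and> euclidean interior_of V = {}" if "V \<in> range G" for V
        using \<open>V \<in> range G\<close> \<open>\<And>n. interior (G n) = {}\<close> by (auto simp: G_def)
    qed simp
    then show ?thesis by simp
  qed
  ultimately have "\<exists>n. interior (G n) \<noteq> {}" by blast
  then obtain n y0 where "y0 \<in> interior (G n)" by blast
  then obtain e where e: "e > 0" and ball: "cball y0 e \<subseteq> G n"
    by (metis mem_interior_cball)
  have "\<exists>x\<in>S. norm x \<le> (2 * real n / e) * norm y \<and> norm (y - f x) < d" if d: "d > 0" for y d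
  proof (cases "y = 0")
    case True
    then show ?thesis using d subspace_0[OF S] by (intro bexI[of _ 0]) (auto simp: f.zero)
  next
    case False
    define t where "t = norm y / e"
    have t: "t > 0" using False e by (simp add: t_def)
    define z where "z = (1 / t) *\<^sub>R y"
    have nz: "norm z = e" using False e by (simp add: z_def t_def)
    have "y0 \<in> G n" "y0 + z \<in> G n"
      using ball e nz by (auto simp: subset_iff dist_norm)
    moreover have "d / (2 * t) > 0" using d t by simp
    ultimately obtain a b where a: "a \<in> S" "norm a \<le> real n" "dist (f a) (y0 + z) < d / (2 * t)"
      and b: "b \<in> S" "norm b \<le> real n" "dist (f b) y0 < d / (2 * t)"
      unfolding G_def closure_approachable by (auto simp: Bex_def) metis
    define x where "x = t *\<^sub>R (a - b)"
    have "x \<in> S" unfolding x_def using a b S by (intro subspace_scale subspace_diff)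
    moreover have "norm x \<le> (2 * real n / e) * norm y"
    proof -
      have "norm (a - b) \<le> 2 * real n" using norm_triangle_ineq4[of a b] a b by linarith
      then have "t * norm (a - b) \<le> t * (2 * real n)" using t by (intro mult_left_mono) auto
      then show ?thesis using t e by (simp add: x_def t_def mult_ac)
    qed
    moreover have "norm (y - f x) < d"
    proof -
      have eq: "y - f x = t *\<^sub>R ((f b - y0) - (f a - (y0 + z)))"
        using t by (simp add: x_def f.scaleR f.diff z_def algebra_simps)
      have "norm ((f b - y0) - (f a - (y0 + z))) < d / t"
        using norm_triangle_ineq4[of "f b - y0" "f a - (y0 + z)"] a(3) b(3)
        by (simp add: dist_norm field_simps)
      then have "t * norm ((f b - y0) - (f a - (y0 + z))) < d" using t by (simp add: field_simps)
      then show ?thesis using t by (simp only: eq norm_scaleR abs_of_pos)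
    qed
    ultimately show ?thesis by blast
  qed
  moreover have "2 * real n / e \<ge> 0" using e by simp
  ultimately show ?thesis using that by blast
qed

text \<open>
  The quantitative open mapping theorem: approximate \<open>y\<close> to within half of its norm, then
  approximate the remainder in the same way, and so on.  The corrections form a geometrically
  convergent series whose sum is an exact preimage.
\<close>
lemma bounded_preimages:
  fixes f :: "'b::banach \<Rightarrow> 'a::banach"
  assumes "bounded_linear f" and S: "subspace S" and "closed S" and onto: "f ` S = UNIV"
  obtains K where "\<And>y. \<exists>x\<in>S. f x = y \<and> norm x \<le> K * norm y"
proof -
  interpret f: bounded_linear f by fact
  obtain C where C: "C \<ge> 0"
    and approx: "\<And>y d. d > 0 \<Longrightarrow> \<exists>x\<in>S. norm x \<le> C * norm y \<and> norm (y - f x) < d"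
    using bounded_approximate_preimages[OF assms(1) S onto] by blast
  have "\<exists>x\<in>S. norm x \<le> C * norm y \<and> norm (y - f x) \<le> norm y / 2" for y
  proof (cases "y = 0")
    case True
    then show ?thesis using subspace_0[OF S] by (intro bexI[of _ 0]) (auto simp: f.zero)
  next
    case False
    then show ?thesis using approx[of "norm y / 2" y] by force
  qed
  then obtain g where g: "\<And>y. g y \<in> S" "\<And>y. norm (g y) \<le> C * norm y"
    "\<And>y. norm (y - f (g y)) \<le> norm y / 2"
    by metis
  have "\<exists>x\<in>S. f x = y \<and> norm x \<le> (2 * C) * norm y" for y
  proof -
    \<comment> \<open>\<open>r k\<close> is the part of \<open>y\<close> that is left after \<open>k\<close> corrections.\<close>
    define r where "r k = ((\<lambda>v. v - f (g v)) ^^ k) y" for k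
    have r_Suc: "r (Suc k) = r k - f (g (r k))" for k by (simp add: r_def)
    have r_bound: "norm (r k) \<le> norm y * (1 / 2) ^ k" for k
    proof (induction k)
      case (Suc k)
      then show ?case using g(3)[of "r k"] by (simp add: r_Suc)
    qed (simp add: r_def)
    have geo: "(\<lambda>k. C * norm y * (1 / 2) ^ k) sums (C * norm y * 2)"
      using sums_mult[OF geometric_sums[of "1 / 2 :: real"], of "C * norm y"] by simp
    have gr: "norm (g (r k)) \<le> C * norm y * (1 / 2) ^ k" for k
      using order_trans[OF g(2)[of "r k"] mult_left_mono[OF r_bound[of k] C]] by (simp add: mult_ac)
    have sn: "summable (\<lambda>k. norm (g (r k)))"
      by (rule summable_comparison_test'[OF sums_summable[OF geo], where N = 0])
        (use gr in simp)
    then have summable_g: "summable (\<lambda>k. g (r k))" by (rule summable_norm_cancel)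
    define x where "x = (\<Sum>k. g (r k))"
    have lim: "(\<lambda>n. \<Sum>k<n. g (r k)) \<longlonglongrightarrow> x"
      unfolding x_def using summable_g by (rule summable_LIMSEQ)
    have "(\<Sum>k<n. g (r k)) \<in> S" for n
      using g(1) by (intro subspace_sum[OF S])
    from \<open>closed S\<close> this lim have "x \<in> S" by (rule closed_sequentially)
    moreover have "f x = y"
    proof -
      have "(\<lambda>k. f (g (r k))) sums f x"
        using f.sums[OF summable_sums[OF summable_g]] by (simp add: x_def)
      moreover have "r \<longlonglongrightarrow> 0"
      proof (rule Lim_null_comparison)
        show "\<forall>\<^sub>F k in sequentially. norm (r k) \<le> norm y * (1 / 2) ^ k" using r_bound by simp
        show "(\<lambda>k. norm y * (1 / 2) ^ k) \<longlonglongrightarrow> 0"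
          by (intro tendsto_mult_right_zero LIMSEQ_power_zero) simp
      qed
      then have "(\<lambda>k. r k - r (Suc k)) sums (r 0 - 0)" by (rule telescope_sums')
      then have "(\<lambda>k. f (g (r k))) sums y" by (simp add: r_Suc) (simp add: r_def)
      ultimately show ?thesis using sums_unique2 by blast
    qed
    moreover have "norm x \<le> (2 * C) * norm y"
    proof -
      have "norm x \<le> (\<Sum>k. norm (g (r k)))" unfolding x_def by (rule summable_norm[OF sn])
      also have "\<dots> \<le> (\<Sum>k. C * norm y * (1 / 2) ^ k)"
        using gr sn sums_summable[OF geo] by (intro suminf_le)
      also have "\<dots> = C * norm y * 2" using geo by (simp add: sums_iff)
      finally show ?thesis by (simp add: mult_ac)
    qed
    ultimately show ?thesis by blast
  qed
  then show ?thesis using that by blast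
qed

text \<open>
  A surjection as in the open mapping theorem is a quotient map, so a set of values is closed as
  soon as its full preimage in \<open>S\<close> is.  Bounded preimages of the differences \<open>u n - y\<close> turn a
  convergent sequence in the image into one in \<open>C\<close>.
\<close>
lemma closed_image_saturated:
  fixes f :: "'b::banach \<Rightarrow> 'a::banach"
  assumes "bounded_linear f" and S: "subspace S" and "closed S" and onto: "f ` S = UNIV"
    and "closed C" and C: "C \<subseteq> S" and sat: "\<And>x. x \<in> S \<Longrightarrow> f x \<in> f ` C \<Longrightarrow> x \<in> C"
  shows "closed (f ` C)"
proof -
  interpret f: bounded_linear f by fact
  obtain K where K: "\<And>y. \<exists>x\<in>S. f x = y \<and> norm x \<le> K * norm y"
    using bounded_preimages[OF assms(1-3) onto] by blast
  show ?thesis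
    unfolding closed_sequential_limits
  proof (intro allI impI, elim conjE)
    fix u y assume u: "\<forall>n. u n \<in> f ` C" and lim: "u \<longlonglongrightarrow> y"
    have "y \<in> f ` S" using onto by simp
    then obtain x where x: "x \<in> S" "f x = y" by auto
    have "\<exists>w. \<forall>n. w n \<in> S \<and> f (w n) = u n - y \<and> norm (w n) \<le> K * norm (u n - y)"
      by (intro choice allI) (use K in blast)
    then obtain w where w: "\<And>n. w n \<in> S" "\<And>n. f (w n) = u n - y"
      "\<And>n. norm (w n) \<le> K * norm (u n - y)"
      by blast
    have "(\<lambda>n. norm (u n - y)) \<longlonglongrightarrow> 0"
      using lim LIM_zero tendsto_norm_zero by blast
    then have "(\<lambda>n. K * norm (u n - y)) \<longlonglongrightarrow> 0" by (rule tendsto_mult_right_zero)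
    then have "w \<longlonglongrightarrow> 0"
      using w(3) by (intro Lim_null_comparison[of w]) auto
    then have lim_xw: "(\<lambda>n. x + w n) \<longlonglongrightarrow> x" using tendsto_add[OF tendsto_const, of w 0 _ x] by simp
    have "x + w n \<in> C" for n
    proof (rule sat)
      show "x + w n \<in> S" using x w S subspace_add by blast
      show "f (x + w n) \<in> f ` C" using u x w by (simp add: f.add)
    qed
    from \<open>closed C\<close> this lim_xw have "x \<in> C" by (rule closed_sequentially)
    then show "y \<in> f ` C" using x by blast
  qed
qed

text \<open>
  The map \<open>h (x, y) = f x + g y\<close> is
  a surjection from \<open>S \<times> R\<close>, and directness says that the preimage of \<open>f ` S\<close> under \<open>h\<close> is
  \<open>S \<times> (R \<inter> {y. g y = 0})\<close>.  Both this set and its mirror image are closed.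
\<close>
lemma closed_images_if_direct_sum:
  fixes f :: "'b::banach \<Rightarrow> 'a::banach" and g :: "'c::banach \<Rightarrow> 'a"
  assumes f: "bounded_linear f" "subspace S" "closed S"
    and g: "bounded_linear g" "subspace R" "closed R"
    and span: "f ` S + g ` R = UNIV" and direct: "f ` S \<inter> g ` R = {0}"
  shows "closed (f ` S)" and "closed (g ` R)"
proof -
  interpret f: bounded_linear f by fact
  interpret g: bounded_linear g by fact
  define h where "h p = f (fst p) + g (snd p)" for p
  have h: "bounded_linear h"
    unfolding h_def
    by (intro bounded_linear_add bounded_linear_compose[OF f(1)] bounded_linear_compose[OF g(1)]
        bounded_linear_fst bounded_linear_snd)
  interpret h: bounded_linear h by (rule h)
  have SR: "subspace (S \<times> R)" "closed (S \<times> R)"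
    using f g by (auto intro: subspace_Times closed_Times)
  have onto: "h ` (S \<times> R) = UNIV"
    using span by (fastforce simp: h_def set_plus_def image_iff)
  have zero: "f x = 0 \<and> g y = 0" if "f x + g y = 0" "x \<in> S" "y \<in> R" for x y
  proof -
    have "f x = g (- y)" using that by (simp add: g.neg add_eq_0_iff)
    moreover have "- y \<in> R" using that g(2) subspace_neg by blast
    ultimately have "f x = 0" using direct that by blast
    then show ?thesis using that by simp
  qed
  have diff: "f (x - x') = 0 \<and> g (y - y') = 0"
    if "f x + g y = f x' + g y'" "x \<in> S" "x' \<in> S" "y \<in> R" "y' \<in> R" for x x' y y'
    using that f(2) g(2) by (intro zero) (auto simp: f.diff g.diff subspace_diff algebra_simps)
  have cl: "closed {y. g y = 0}" "closed {x. f x = 0}"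
    using f.continuous_on[OF continuous_on_id] g.continuous_on[OF continuous_on_id]
    by (auto intro!: closed_Collect_eq)
  define A where "A = S \<times> (R \<inter> {y. g y = 0})"
  define B where "B = (S \<inter> {x. f x = 0}) \<times> R"
  have "0 \<in> S" "0 \<in> R" using f(2) g(2) subspace_0 by auto
  then have "h ` A = f ` S" "h ` B = g ` R"
    by (force simp: h_def A_def B_def f.zero g.zero image_iff)+
  moreover have "closed (h ` A)"
  proof (rule closed_image_saturated[OF h SR onto])
    show "closed A" unfolding A_def using f(3) g(3) cl by (intro closed_Times closed_Int)
    show "A \<subseteq> S \<times> R" by (auto simp: A_def)
    fix p assume p: "p \<in> S \<times> R" "h p \<in> h ` A"
    then obtain x' y' where "x' \<in> S" "y' \<in> R" "g y' = 0" "h p = f x' + g y'"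
      by (auto simp: A_def h_def)
    then show "p \<in> A"
      using p diff[of "fst p" "snd p" x' y'] by (auto simp: A_def h_def g.diff)
  qed
  moreover have "closed (h ` B)"
  proof (rule closed_image_saturated[OF h SR onto])
    show "closed B" unfolding B_def using f(3) g(3) cl by (intro closed_Times closed_Int)
    show "B \<subseteq> S \<times> R" by (auto simp: B_def)
    fix p assume p: "p \<in> S \<times> R" "h p \<in> h ` B"
    then obtain x' y' where "x' \<in> S" "y' \<in> R" "f x' = 0" "h p = f x' + g y'"
      by (auto simp: B_def h_def)
    then show "p \<in> B"
      using p diff[of "fst p" "snd p" x' y'] by (auto simp: B_def h_def f.diff)
  qed
  ultimately show "closed (f ` S)" "closed (g ` R)" by simp_all
qed

section \<open>Ranges and kernels of iterates\<close>

abbreviation csubspace :: "'a::complex_normed_vector set \<Rightarrow> bool" where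
  "csubspace \<equiv> complex_vector.subspace"

lemma csubspace_imp_subspace: "csubspace S \<Longrightarrow> subspace S"
  by (auto simp: subspace_def complex_vector.subspace_def scaleR_scaleC)

lemma csubspace_plus:
  assumes "csubspace S" "csubspace R"
  shows "csubspace (S + R)"
proof -
  have "S + R = {x + y |x y. x \<in> S \<and> y \<in> R}" by (auto simp: set_plus_def)
  then show ?thesis using complex_vector.subspace_sums[OF assms] by simp
qed

locale clinear_operator =
  fixes T :: "'a::complex_normed_vector \<Rightarrow> 'a"
  assumes clinear: "Vector_Spaces.linear scaleC scaleC T"
begin

lemma T_add: "T (x + y) = T x + T y"
  and T_scaleC: "T (c *\<^sub>C x) = c *\<^sub>C T x"
  using clinear by (auto simp: Vector_Spaces.linear_iff)

lemma pow_add: "(T ^^ k) (x + y) = (T ^^ k) x + (T ^^ k) y"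
  by (induction k) (auto simp: T_add)

lemma pow_scaleC: "(T ^^ k) (c *\<^sub>C x) = c *\<^sub>C (T ^^ k) x"
  by (induction k) (auto simp: T_scaleC)

lemma pow_zero: "(T ^^ k) 0 = 0"
  using pow_add[of k 0 0] by simp

lemma pow_diff: "(T ^^ k) (x - y) = (T ^^ k) x - (T ^^ k) y"
  using pow_add[of k "x - y" y] by simp

lemma pow_pow: "(T ^^ i) ((T ^^ j) x) = (T ^^ (i + j)) x"
  by (simp add: funpow_add)

lemma clinear_pow: "clinear_operator (T ^^ k)"
  by standard (auto simp: Vector_Spaces.linear_iff pow_add pow_scaleC
      intro: complex_vector.vector_space_axioms)

lemma csubspace_kernel_pow: "csubspace (kernel (T ^^ k))"
  by (auto simp: complex_vector.subspace_def kernel_def pow_add pow_scaleC pow_zero)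

lemma csubspace_image_pow:
  assumes "csubspace S"
  shows "csubspace ((T ^^ k) ` S)"
  unfolding complex_vector.subspace_def
proof (intro conjI ballI allI)
  show "0 \<in> (T ^^ k) ` S"
    using complex_vector.subspace_0[OF assms] by (intro image_eqI[of _ _ 0]) (simp_all add: pow_zero)
  show "x + y \<in> (T ^^ k) ` S" if "x \<in> (T ^^ k) ` S" "y \<in> (T ^^ k) ` S" for x y
    using that complex_vector.subspace_add[OF assms] by (auto simp flip: pow_add)
  show "c *\<^sub>C x \<in> (T ^^ k) ` S" if "x \<in> (T ^^ k) ` S" for c x
    using that complex_vector.subspace_scale[OF assms] by (auto simp flip: pow_scaleC)
qed

lemma csubspace_range_pow: "csubspace (range (T ^^ k))"
  by (intro csubspace_image_pow complex_vector.subspace_UNIV)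

lemma kernel_pow_mono: "i \<le> j \<Longrightarrow> kernel (T ^^ i) \<subseteq> kernel (T ^^ j)"
  by (auto simp: kernel_def) (metis pow_pow[of "j - i" i] pow_zero le_add_diff_inverse2)

lemma range_pow_antimono: "i \<le> j \<Longrightarrow> range (T ^^ j) \<subseteq> range (T ^^ i)"
  using pow_pow[of i "j - i", symmetric] by auto

definition range_ker :: "nat \<Rightarrow> nat \<Rightarrow> 'a set" where
  "range_ker n j = range (T ^^ j) + kernel (T ^^ n)"

lemma range_kerI: "(T ^^ n) z = 0 \<Longrightarrow> x = (T ^^ j) y + z \<Longrightarrow> x \<in> range_ker n j"
  by (auto simp: range_ker_def kernel_def)

lemma range_kerE:
  assumes "x \<in> range_ker n j"
  obtains y z where "(T ^^ n) z = 0" "x = (T ^^ j) y + z"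
  using assms by (auto simp: range_ker_def kernel_def elim!: set_plus_elim)

lemma csubspace_range_ker: "csubspace (range_ker n j)"
  unfolding range_ker_def by (intro csubspace_plus csubspace_range_pow csubspace_kernel_pow)

lemma range_ker_antimono: "i \<le> j \<Longrightarrow> range_ker n j \<subseteq> range_ker n i"
  unfolding range_ker_def by (intro set_plus_mono2 range_pow_antimono order_refl)

lemma kernel_subset_range_ker: "kernel (T ^^ n) \<subseteq> range_ker n j"
  by (auto simp: kernel_def pow_zero intro: range_kerI[where y = 0])

lemma pow_in_range_ker:
  assumes "x \<in> range_ker n j"
  shows "(T ^^ i) x \<in> range_ker n (i + j)"
proof -
  obtain y z where z: "(T ^^ n) z = 0" and x: "x = (T ^^ j) y + z" using assms by (rule range_kerE)
  have "(T ^^ n) ((T ^^ i) z) = (T ^^ i) ((T ^^ n) z)" by (simp only: pow_pow add.commute)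
  then show ?thesis using x z by (intro range_kerI[where z = "(T ^^ i) z" and y = y])
      (simp_all add: pow_add pow_pow pow_zero)
qed

definition stable_from :: "nat \<Rightarrow> bool" where
  "stable_from n \<longleftrightarrow> (\<forall>k\<ge>n. kernel T \<inter> range (T ^^ k) = kernel T \<inter> range (T ^^ n))"

lemma stable_from_mono: "stable_from n \<Longrightarrow> n \<le> k \<Longrightarrow> stable_from k"
  unfolding stable_from_def by (metis order_trans)

text \<open>
  Let \<open>x \<in> kernel (T ^^ (k + 1))\<close> with \<open>k \<ge> n\<close>.  Then \<open>(T ^^ k) x\<close> lies in \<open>kernel T \<inter> range (T ^^ k)\<close>, which
  by stability is contained in \<open>range (T ^^ (k + j))\<close>.  Subtracting a suitable \<open>(T ^^ j) y\<close> from \<open>x\<close> thus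
  leaves an element of \<open>kernel (T ^^ k)\<close>, and induction on \<open>k\<close> applies.
\<close>
lemma kernel_pow_subset_range_ker:
  assumes "stable_from n"
  shows "kernel (T ^^ k) \<subseteq> range_ker n j"
proof (cases "k \<le> n")
  case True
  then show ?thesis using kernel_pow_mono kernel_subset_range_ker by blast
next
  case False
  then have "n \<le> k" by simp
  then show ?thesis
  proof (induction k rule: dec_induct)
    case base
    show ?case by (rule kernel_subset_range_ker)
  next
    case (step k)
    show ?case
    proof
      fix x assume "x \<in> kernel (T ^^ Suc k)"
      then have "(T ^^ k) x \<in> kernel T \<inter> range (T ^^ k)" by (simp add: kernel_def)
      also have "\<dots> = kernel T \<inter> range (T ^^ (k + j))"
        using assms step.hyps unfolding stable_from_def by (metis trans_le_add1)
      finally obtain y where "(T ^^ k) x = (T ^^ (k + j)) y" by auto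
      then have "(T ^^ k) (x - (T ^^ j) y) = 0" by (simp add: pow_diff pow_pow)
      then have "x - (T ^^ j) y \<in> range_ker n j" using step.IH by (auto simp: kernel_def)
      moreover have "(T ^^ j) y \<in> range_ker n j" by (rule range_kerI[where z = 0]) (auto simp: pow_zero)
      ultimately show "x \<in> range_ker n j"
        using complex_vector.subspace_add[OF csubspace_range_ker] by fastforce
    qed
  qed
qed

lemma range_ker_eq_if_stable:
  assumes "stable_from n" "n \<le> k"
  shows "range_ker k j = range_ker n j"
proof
  show "range_ker n j \<subseteq> range_ker k j"
    unfolding range_ker_def by (intro set_plus_mono2 kernel_pow_mono assms order_refl)
  show "range_ker k j \<subseteq> range_ker n j"
  proof
    fix x assume "x \<in> range_ker k j"
    then obtain y z where "(T ^^ k) z = 0" "x = (T ^^ j) y + z" by (rule range_kerE)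
    moreover from this have "z \<in> range_ker n j"
      using kernel_pow_subset_range_ker[OF assms(1), of k j] by (auto simp: kernel_def)
    moreover have "(T ^^ j) y \<in> range_ker n j" by (rule range_kerI[where z = 0]) (auto simp: pow_zero)
    ultimately show "x \<in> range_ker n j"
      using complex_vector.subspace_add[OF csubspace_range_ker] by simp
  qed
qed

text \<open>
  Injectivity of the shift that \<open>T ^^ i\<close> induces from the quotient by \<open>range_ker n j\<close> to the quotient by
  \<open>range_ker n (i + j)\<close>: the kernel elements that could spoil it lie in \<open>range_ker n j\<close> already.
\<close>
lemma range_ker_cancel_pow:
  assumes "stable_from n" "(T ^^ i) x \<in> range_ker n (i + j)"
  shows "x \<in> range_ker n j"
proof -
  obtain y z where z: "(T ^^ n) z = 0" and x: "(T ^^ i) x = (T ^^ (i + j)) y + z"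
    using assms(2) by (rule range_kerE)
  have "(T ^^ i) (x - (T ^^ j) y) = z" by (simp add: pow_diff pow_pow x)
  then have "(T ^^ (n + i)) (x - (T ^^ j) y) = 0" using z by (simp flip: pow_pow)
  then have "x - (T ^^ j) y \<in> range_ker n j"
    using kernel_pow_subset_range_ker[OF assms(1), of "n + i" j] by (auto simp: kernel_def)
  moreover have "(T ^^ j) y \<in> range_ker n j" by (rule range_kerI[where z = 0]) (auto simp: pow_zero)
  ultimately show "x \<in> range_ker n j"
    using complex_vector.subspace_add[OF csubspace_range_ker] by fastforce
qed

end

section \<open>Complements of the range-plus-kernel subspaces\<close>

lemma topologically_complementedI:
  fixes f :: "'b::banach \<Rightarrow> 'a::complex_banach" and g :: "'c::banach \<Rightarrow> 'a"
  assumes "bounded_linear f" "subspace S" "closed S"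
    and "bounded_linear g" "subspace R" "closed R"
    and "csubspace (f ` S)" "csubspace (g ` R)"
    and "f ` S + g ` R = UNIV" "f ` S \<inter> g ` R = {0}"
  shows "topologically_complemented (f ` S)"
  using closed_images_if_direct_sum[OF assms(1-6,9-10)] assms(7-10)
  unfolding topologically_complemented_def by blast

locale bounded_clinear_operator =
  fixes T :: "'a::complex_banach \<Rightarrow> 'a"
  assumes bounded_clinear: "bounded_clinear T"
begin

sublocale clinear_operator T
  by (rule clinear_operator.intro) (use bounded_clinear in \<open>simp add: bounded_clinear_def\<close>)

lemma bounded_linear_T: "bounded_linear T"
proof -
  obtain K where "\<And>x. norm (T x) \<le> K * norm x"
    using bounded_clinear by (auto simp: bounded_clinear_def)
  then show ?thesis
    by (intro bounded_linear_intro[where K = K])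
      (auto simp: T_add T_scaleC scaleR_scaleC mult.commute)
qed

lemma bounded_linear_pow: "bounded_linear (T ^^ k)"
  by (induction k) (auto intro: bounded_linear_compose[OF bounded_linear_T] bounded_linear_ident
      simp: o_def id_def)

lemma closed_kernel_pow: "closed (kernel (T ^^ k))"
proof -
  interpret b: bounded_linear "T ^^ k" by (rule bounded_linear_pow)
  show ?thesis
    unfolding kernel_def by (intro closed_Collect_eq continuous_on_const b.continuous_on continuous_on_id)
qed

lemma range_ker_eq_image: "range_ker n j = (\<lambda>p. (T ^^ j) (fst p) + snd p) ` (UNIV \<times> kernel (T ^^ n))"
  by (force simp: range_ker_def set_plus_def)

lemma bounded_linear_pow_plus: "bounded_linear (\<lambda>p. (T ^^ j) (fst p) + snd p)"
  by (intro bounded_linear_add bounded_linear_compose[OF bounded_linear_pow]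
      bounded_linear_fst bounded_linear_snd)

text \<open>
  \<open>range_ker n j\<close> is itself the range of a bounded operator on \<open>UNIV \<times> kernel (T ^^ n)\<close>, so any
  algebraic complement that is an operator range makes it topologically complemented.
\<close>
lemma topologically_complemented_range_kerI:
  fixes g :: "'c::banach \<Rightarrow> 'a"
  assumes "bounded_linear g" "subspace R" "closed R" "csubspace (g ` R)"
    and cover: "\<And>x. \<exists>v\<in>range_ker n j. \<exists>r\<in>R. x = v + g r"
    and direct: "\<And>r. r \<in> R \<Longrightarrow> g r \<in> range_ker n j \<Longrightarrow> g r = 0"
  shows "topologically_complemented (range_ker n j)"
  unfolding range_ker_eq_image
proof (rule topologically_complementedI[OF bounded_linear_pow_plus _ _ assms(1-3)])
  show "subspace (UNIV \<times> kernel (T ^^ n))"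
    by (intro subspace_Times csubspace_imp_subspace csubspace_kernel_pow subspace_UNIV)
  show "closed (UNIV \<times> kernel (T ^^ n))" by (intro closed_Times closed_UNIV closed_kernel_pow)
  have "0 \<in> range_ker n j" "0 \<in> g ` R"
    using complex_vector.subspace_0 csubspace_range_ker assms(4) by blast+
  then show "(\<lambda>p. (T ^^ j) (fst p) + snd p) ` (UNIV \<times> kernel (T ^^ n)) \<inter> g ` R = {0}"
    unfolding range_ker_eq_image[symmetric] using direct by auto
  show "(\<lambda>p. (T ^^ j) (fst p) + snd p) ` (UNIV \<times> kernel (T ^^ n)) + g ` R = UNIV"
    unfolding range_ker_eq_image[symmetric] using cover by (auto simp: set_plus_def)
qed (use assms(4) csubspace_range_ker in \<open>simp_all add: range_ker_eq_image[symmetric]\<close>)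

text \<open>
  The step up.  Write the first component of \<open>range_ker n j + M\<close> as \<open>(T ^^ j) a + b\<close> and split \<open>a\<close> along
  \<open>range_ker n 1 + N\<close>: the complement grows by \<open>(T ^^ j) ` N\<close>.  The new sum is direct because \<open>T ^^ j\<close>
  can be cancelled from \<open>(T ^^ j) u \<in> range_ker n (j + 1)\<close>.
\<close>
lemma topologically_complemented_range_ker_Suc:
  assumes stable: "stable_from n" and "topologically_complemented (range_ker n 1)"
    and "topologically_complemented (range_ker n j)"
  shows "topologically_complemented (range_ker n (Suc j))"
proof -
  obtain N where N: "csubspace N" "closed N" "range_ker n 1 \<inter> N = {0}" "range_ker n 1 + N = UNIV"
    using assms(2) by (auto simp: topologically_complemented_def)
  obtain M where M: "csubspace M" "closed M" "range_ker n j \<inter> M = {0}" "range_ker n j + M = UNIV"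
    using assms(3) by (auto simp: topologically_complemented_def)
  let ?g = "\<lambda>p. (T ^^ j) (fst p) + snd p"
  show ?thesis
  proof (rule topologically_complemented_range_kerI[of ?g "N \<times> M"])
    show "bounded_linear ?g" by (rule bounded_linear_pow_plus)
    show "subspace (N \<times> M)" using N M by (intro subspace_Times csubspace_imp_subspace)
    show "closed (N \<times> M)" using N M by (intro closed_Times)
    have "csubspace ((T ^^ j) ` N)" by (rule csubspace_image_pow) (rule N)
    moreover have "?g ` (N \<times> M) = (T ^^ j) ` N + M" by (force simp: set_plus_def)
    ultimately show "csubspace (?g ` (N \<times> M))" using csubspace_plus M(1) by metis
    show "\<exists>v\<in>range_ker n (Suc j). \<exists>r\<in>N \<times> M. x = v + ?g r" for x
    proof -
      obtain a' w where a': "a' \<in> range_ker n j" and w: "w \<in> M" "x = a' + w"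
        using M(4) by (metis UNIV_I set_plus_elim)
      obtain a b where a: "(T ^^ n) b = 0" "a' = (T ^^ j) a + b" using a' by (rule range_kerE)
      obtain v u where v: "v \<in> range_ker n 1" and u: "u \<in> N" "a = v + u"
        using N(4) by (metis UNIV_I set_plus_elim)
      have "(T ^^ j) v \<in> range_ker n (Suc j)" using pow_in_range_ker[OF v, of j] by simp
      moreover have "b \<in> range_ker n (Suc j)" using kernel_subset_range_ker a by (auto simp: kernel_def)
      ultimately have "(T ^^ j) v + b \<in> range_ker n (Suc j)"
        using complex_vector.subspace_add[OF csubspace_range_ker] by blast
      moreover have "x = ((T ^^ j) v + b) + ?g (u, w)"
        using a u w by (simp add: pow_add algebra_simps)
      ultimately show ?thesis using u w by blast
    qed
    show "?g r = 0" if r: "r \<in> N \<times> M" and g: "?g r \<in> range_ker n (Suc j)" for r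
    proof -
      obtain u w where uw: "r = (u, w)" "u \<in> N" "w \<in> M" using r by auto
      have "(T ^^ j) u \<in> range_ker n j" by (rule range_kerI[where z = 0]) (auto simp: pow_zero)
      moreover have "?g r \<in> range_ker n j" using g range_ker_antimono[of j "Suc j" n] by auto
      ultimately have "?g r - (T ^^ j) u \<in> range_ker n j"
        using complex_vector.subspace_diff[OF csubspace_range_ker] by blast
      then have w: "w = 0" using M(3) uw by auto
      then have "u \<in> range_ker n 1" using g uw range_ker_cancel_pow[OF stable, of j u 1] by simp
      then have "u = 0" using N(3) uw by blast
      then show ?thesis using uw w by (simp add: pow_zero)
    qed
  qed
qed

lemma topologically_complemented_range_ker_pow:
  assumes "stable_from n" and "topologically_complemented (range_ker n 1)"
  shows "topologically_complemented (range_ker n j)"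
proof (induction j)
  case 0
  have "x \<in> range_ker n 0" for x by (rule range_kerI[where z = 0 and y = x]) (simp_all add: pow_zero)
  then have "range_ker n 0 = UNIV" by blast
  moreover have "topologically_complemented (UNIV :: 'a set)"
    unfolding topologically_complemented_def
    by (intro conjI exI[of _ "{0}"]) (auto simp: set_plus_def)
  ultimately show ?case by simp
next
  case (Suc j)
  then show ?case using topologically_complemented_range_ker_Suc assms by blast
qed

text \<open>
  The step down.  The complement of \<open>range_ker n 1\<close> consists of those \<open>w \<in> M\<close> that some \<open>v\<close> in
  \<open>range_ker n (Suc j)\<close> moves into the preimage of \<open>M + kernel (T ^^ n)\<close> under \<open>T ^^ j\<close>.

  It spans together with \<open>range_ker n 1\<close>: decompose \<open>(T ^^ j) x = (T ^^ (j + 1)) y + z + w'\<close> with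
  \<open>z \<in> kernel (T ^^ n)\<close> and \<open>w' \<in> M\<close>; then \<open>x - T y\<close> lies in that preimage, and its \<open>M\<close>-component is the
  required \<open>w\<close>.

  It meets \<open>range_ker n 1\<close> only in \<open>0\<close>: for \<open>w\<close> in both, \<open>(T ^^ j) (w + v)\<close> lies in
  \<open>range_ker n (Suc j)\<close>, so its \<open>M\<close>-part vanishes and \<open>w + v\<close> is in some \<open>kernel (T ^^ k)\<close>.  By stability
  that kernel lies in \<open>range_ker n (Suc j)\<close>, whence so does \<open>w\<close>.
\<close>
lemma topologically_complemented_range_ker_one:
  assumes stable: "stable_from n" and "topologically_complemented (range_ker n (Suc j))"
  shows "topologically_complemented (range_ker n 1)"
proof -
  let ?V = "range_ker n (Suc j)"
  have cl: "closed ?V" using assms(2) by (simp add: topologically_complemented_def)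
  obtain M where M: "csubspace M" "closed M" "?V \<inter> M = {0}" "?V + M = UNIV"
    using assms(2) unfolding topologically_complemented_def by blast
  have V1: "?V \<subseteq> range_ker n 1" by (rule range_ker_antimono) simp
  \<comment> \<open>Recording \<open>v\<close> and the kernel part \<open>u\<close> as well makes \<open>R\<close> a closed subspace, and exhibits the
    complement as the range of the bounded operator \<open>fst\<close> on it.\<close>
  define R where "R = {(w, v, u). w \<in> M \<and> v \<in> ?V \<and> u \<in> kernel (T ^^ n) \<and> (T ^^ j) (w + v) - u \<in> M}"
  have R_eq: "R = (M \<times> ?V \<times> kernel (T ^^ n)) \<inter> (\<lambda>(w, v, u). (T ^^ j) (w + v) - u) -` M"
    by (auto simp: R_def)
  note csub = M(1) csubspace_range_ker[of n "Suc j"] csubspace_kernel_pow[of n]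
  interpret b: bounded_linear "T ^^ j" by (rule bounded_linear_pow)
  show ?thesis
  proof (rule topologically_complemented_range_kerI[of fst R])
    show "bounded_linear (fst :: 'a \<times> 'a \<times> 'a \<Rightarrow> 'a)" by (rule bounded_linear_fst)
    have R0: "0 \<in> R"
      using csub[THEN complex_vector.subspace_0] by (auto simp: R_def pow_zero zero_prod_def)
    have R_add: "(w + w', v + v', u + u') \<in> R" if "(w, v, u) \<in> R" "(w', v', u') \<in> R" for w v u w' v' u'
    proof -
      have "(T ^^ j) ((w + w') + (v + v')) - (u + u') =
          ((T ^^ j) (w + v) - u) + ((T ^^ j) (w' + v') - u')"
        by (simp add: pow_add algebra_simps)
      also have "\<dots> \<in> M"
        using that complex_vector.subspace_add[OF M(1)] by (simp add: R_def)
      finally show ?thesis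
        using that csub[THEN complex_vector.subspace_add] by (simp add: R_def)
    qed
    have R_scale: "(c *\<^sub>C w, c *\<^sub>C v, c *\<^sub>C u) \<in> R" if "(w, v, u) \<in> R" for c w v u
    proof -
      have "(T ^^ j) (c *\<^sub>C w + c *\<^sub>C v) - c *\<^sub>C u = c *\<^sub>C ((T ^^ j) (w + v) - u)"
        by (simp add: pow_add pow_scaleC scaleC_add_right complex_vector.scale_right_diff_distrib)
      also have "\<dots> \<in> M"
        using that complex_vector.subspace_scale[OF M(1)] by (simp add: R_def)
      finally show ?thesis
        using that csub[THEN complex_vector.subspace_scale] by (simp add: R_def)
    qed
    show "subspace R"
      unfolding subspace_def
    proof (intro conjI ballI allI R0)
      show "p + q \<in> R" if "p \<in> R" "q \<in> R" for p q
        using that R_add by (cases p; cases q) auto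
      show "c *\<^sub>R p \<in> R" if "p \<in> R" for c p
        using that R_scale by (cases p) (auto simp: scaleR_scaleC)
    qed
    show "csubspace (fst ` R)"
      unfolding complex_vector.subspace_def
    proof (intro conjI ballI allI)
      show "0 \<in> fst ` R" using R0 by (metis fst_zero imageI)
      show "x + y \<in> fst ` R" if xy: "x \<in> fst ` R" "y \<in> fst ` R" for x y
      proof -
        obtain v u v' u' where "(x, v, u) \<in> R" "(y, v', u') \<in> R" using xy by auto
        then show ?thesis using R_add by (metis fst_conv imageI)
      qed
      show "c *\<^sub>C x \<in> fst ` R" if x: "x \<in> fst ` R" for c x
      proof -
        obtain v u where "(x, v, u) \<in> R" using x by auto
        then show ?thesis using R_scale by (metis fst_conv imageI)
      qed
    qed
    show "closed R"
      unfolding R_eq case_prod_unfold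
      by (intro closed_Int closed_Times M cl closed_kernel_pow closed_vimage[OF M(2)]
          continuous_intros b.continuous_on)
    show "\<exists>v\<in>range_ker n 1. \<exists>r\<in>R. x = v + fst r" for x
    proof -
      obtain a' w' where a': "a' \<in> ?V" and w': "w' \<in> M" "(T ^^ j) x = a' + w'"
        using M(4) by (metis UNIV_I set_plus_elim)
      obtain y z where y: "(T ^^ n) z = 0" "a' = (T ^^ Suc j) y + z" using a' by (rule range_kerE)
      obtain v w where v: "v \<in> ?V" "w \<in> M" "x - T y = v + w"
        using M(4) by (metis UNIV_I set_plus_elim)
      have "(T ^^ j) (w + v) = (T ^^ j) (x - T y)" using v by (simp add: add.commute)
      also have "\<dots> = z + w'" using y w' by (simp add: pow_diff funpow_swap1)
      finally have "(w, v, z) \<in> R" using v y w' by (simp add: R_def kernel_def)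
      moreover have "T y \<in> range_ker n 1" by (rule range_kerI[where z = 0 and y = y]) (auto simp: pow_zero)
      then have "T y + v \<in> range_ker n 1"
        using V1 v complex_vector.subspace_add[OF csubspace_range_ker] by blast
      moreover have "x = (T y + v) + fst (w, v, z)" using v by (simp add: algebra_simps)
      ultimately show ?thesis by blast
    qed
    show "fst r = 0" if r: "r \<in> R" "fst r \<in> range_ker n 1" for r
    proof -
      obtain w v u where wvu: "r = (w, v, u)" "w \<in> M" "v \<in> ?V" "u \<in> kernel (T ^^ n)"
        "(T ^^ j) (w + v) - u \<in> M"
        using r by (auto simp: R_def)
      have "w + v \<in> range_ker n 1"
        using r wvu V1 complex_vector.subspace_add[OF csubspace_range_ker] by auto
      then have "(T ^^ j) (w + v) \<in> ?V" using pow_in_range_ker[of "w + v" n 1 j] by simp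
      moreover have "u \<in> ?V" using wvu kernel_subset_range_ker by blast
      ultimately have "(T ^^ j) (w + v) - u \<in> ?V"
        using complex_vector.subspace_diff[OF csubspace_range_ker] by blast
      then have "(T ^^ j) (w + v) - u \<in> {0}" using wvu(5) M(3) by blast
      then have "(T ^^ j) (w + v) = u" by simp
      then have "(T ^^ n) ((T ^^ j) (w + v)) = 0" using wvu(4) by (simp add: kernel_def)
      then have "(T ^^ (n + j)) (w + v) = 0" by (simp only: pow_pow)
      then have "w + v \<in> ?V"
        using kernel_pow_subset_range_ker[OF stable, of "n + j" "Suc j"] by (auto simp: kernel_def)
      then have "(w + v) - v \<in> ?V"
        using wvu complex_vector.subspace_diff[OF csubspace_range_ker] by blast
      then have "w \<in> ?V" by simp
      then have "w \<in> {0}" using wvu(2) M(3) by blast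
      then show ?thesis using wvu(1) by simp
    qed
  qed
qed

end

section \<open>Finite-dimensional subspaces\<close>

lemma finite_dim_csubspace_subset:
  assumes "csubspace A" "A \<subseteq> B" "finite_dim B"
  shows "finite_dim A"
proof -
  obtain F where F: "finite F" "complex_vector.span F = B"
    using assms(3) by (auto simp: finite_dim_def)
  obtain D where D: "D \<subseteq> A" "complex_vector.independent D" "A \<subseteq> complex_vector.span D"
    using complex_vector.maximal_independent_subset by blast
  have "finite D"
    using complex_vector.independent_span_bound[OF F(1) D(2)] D(1) assms(2) F(2) by blast
  moreover have "complex_vector.span D = A"
    using D complex_vector.span_minimal[OF D(1) assms(1)] by blast
  ultimately show ?thesis unfolding finite_dim_def by blast
qed

lemma csubspace_eq_if_dim_le:
  assumes "csubspace A" "A \<subseteq> B" "finite_dim B" "complex_vector.dim B \<le> complex_vector.dim A"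
  shows "A = B"
proof -
  obtain F where F: "finite F" "complex_vector.span F = B"
    using assms(3) by (auto simp: finite_dim_def)
  obtain C where C: "C \<subseteq> A" "complex_vector.independent C" "card C = complex_vector.dim A"
    using complex_vector.basis_exists by metis
  obtain D where D: "C \<subseteq> D" "D \<subseteq> B" "complex_vector.independent D" "B \<subseteq> complex_vector.span D"
    using complex_vector.maximal_independent_subset_extend[of C B] C assms(2) by (metis subset_trans)
  have "finite D"
    using complex_vector.independent_span_bound[OF F(1) D(3)] D(2) F(2) by blast
  moreover have "card D = complex_vector.dim B"
    using complex_vector.basis_card_eq_dim D by blast
  ultimately have "C = D" using D(1) C(3) assms(4) by (simp add: card_seteq)
  then show ?thesis
    using D(4) C(1) assms(1,2) complex_vector.span_minimal by blast
qed

lemma finite_dim_chain_stabilizes: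
  fixes A :: "nat \<Rightarrow> 'a::complex_normed_vector set"
  assumes sub: "\<And>n. csubspace (A n)" and dec: "\<And>i j. i \<le> j \<Longrightarrow> A j \<subseteq> A i"
    and "finite_dim (A n0)"
  shows "\<exists>n. \<forall>k\<ge>n. A k = A n"
proof -
  obtain n where n: "n0 \<le> n"
    and least: "\<And>k. n0 \<le> k \<Longrightarrow> complex_vector.dim (A n) \<le> complex_vector.dim (A k)"
    using ex_has_least_nat[of "\<lambda>n. n0 \<le> n" n0 "\<lambda>n. complex_vector.dim (A n)"] by auto
  have "finite_dim (A n)" using finite_dim_csubspace_subset sub dec[OF n] assms(3) by blast
  then have "A k = A n" if "n \<le> k" for k
    using csubspace_eq_if_dim_le[OF sub dec[OF that]] least[of k] n that by simp
  then show ?thesis by blast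
qed

context clinear_operator
begin

text \<open>
  The nontrivial half of rank-nullity: lifts of a spanning set of the image, together with a spanning
  set of the kernel, span \<open>A\<close>.
\<close>
lemma finite_dim_if_finite_dim_image:
  assumes A: "csubspace A" and ker: "finite_dim (A \<inter> kernel T)" and im: "finite_dim (T ` A)"
  shows "finite_dim A"
proof -
  obtain F where F: "finite F" "complex_vector.span F = T ` A"
    using im by (auto simp: finite_dim_def)
  obtain G where G: "finite G" "complex_vector.span G = A \<inter> kernel T"
    using ker by (auto simp: finite_dim_def)
  have "F \<subseteq> T ` A" using F(2) complex_vector.span_superset by blast
  then obtain C where C: "C \<subseteq> A" "finite C" "F = T ` C"
    using F(1) finite_subset_image by metis
  have "complex_vector.span (C \<union> G) \<subseteq> A"
    using C(1) G(2) complex_vector.span_superset A by (intro complex_vector.span_minimal) blast+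
  moreover have "x \<in> complex_vector.span (C \<union> G)" if x: "x \<in> A" for x
  proof -
    have "csubspace (T ` complex_vector.span C)"
      using csubspace_image_pow[of "complex_vector.span C" 1] by simp
    then have "complex_vector.span F \<subseteq> T ` complex_vector.span C"
      using C(3) complex_vector.span_superset by (intro complex_vector.span_minimal) blast+
    then obtain c where c: "c \<in> complex_vector.span C" "T x = T c" using x F(2) by auto
    have "c \<in> A" using c(1) C(1) A complex_vector.span_minimal by blast
    then have "x - c \<in> A" using x A complex_vector.subspace_diff by blast
    moreover have "x - c \<in> kernel T" using c(2) pow_diff[of 1 x c] by (simp add: kernel_def)
    ultimately have "x - c \<in> complex_vector.span G" using G(2) by blast
    then have "x - c \<in> complex_vector.span (C \<union> G)" "c \<in> complex_vector.span (C \<union> G)"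
      using c(1) complex_vector.span_mono[of G "C \<union> G"] complex_vector.span_mono[of C "C \<union> G"]
      by auto
    then show ?thesis using complex_vector.span_add[of "x - c" "C \<union> G" c] by simp
  qed
  ultimately have "complex_vector.span (C \<union> G) = A" by blast
  then show ?thesis using C(2) G(1) unfolding finite_dim_def by blast
qed

lemma csubspace_kernel_Int_range: "csubspace (kernel (T ^^ m) \<inter> range (T ^^ n))"
  by (intro complex_vector.subspace_inter csubspace_kernel_pow csubspace_range_pow)

lemma csubspace_kernel_T_Int_range: "csubspace (kernel T \<inter> range (T ^^ n))"
  using csubspace_kernel_Int_range[of 1 n] by simp

text \<open>
  \<open>T\<close> maps \<open>kernel (T ^^ (m + 1)) \<inter> range (T ^^ k)\<close> into \<open>kernel (T ^^ m) \<inter> range (T ^^ (k + 1))\<close>, with kernel inside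
  \<open>kernel T \<inter> range (T ^^ n)\<close>; so rank-nullity and induction on \<open>m\<close> apply.
\<close>
lemma finite_dim_kernel_pow_Int_range:
  assumes "finite_dim (kernel T \<inter> range (T ^^ n))" "n \<le> k"
  shows "finite_dim (kernel (T ^^ m) \<inter> range (T ^^ k))"
  using assms(2)
proof (induction m arbitrary: k)
  case 0
  have "complex_vector.span {} = kernel (T ^^ 0) \<inter> range (T ^^ k)"
    by (auto simp: kernel_def image_iff intro!: exI[of _ 0] pow_zero[symmetric])
  then show ?case unfolding finite_dim_def by blast
next
  case (Suc m)
  let ?A = "kernel (T ^^ Suc m) \<inter> range (T ^^ k)"
  have A: "csubspace ?A" by (rule csubspace_kernel_Int_range)
  show ?case
  proof (rule finite_dim_if_finite_dim_image[OF A])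
    have "csubspace (?A \<inter> kernel T)"
      using complex_vector.subspace_inter[OF A csubspace_kernel_pow[of 1]] by simp
    moreover have "?A \<inter> kernel T \<subseteq> kernel T \<inter> range (T ^^ n)"
      using range_pow_antimono[OF Suc.prems] by blast
    ultimately show "finite_dim (?A \<inter> kernel T)"
      using finite_dim_csubspace_subset assms(1) by blast
    have "csubspace (T ` ?A)" using csubspace_image_pow[OF A, of 1] by simp
    moreover have "T ` ?A \<subseteq> kernel (T ^^ m) \<inter> range (T ^^ Suc k)"
      by (auto simp: kernel_def funpow_swap1)
    ultimately show "finite_dim (T ` ?A)"
      using finite_dim_csubspace_subset Suc.IH[of "Suc k"] Suc.prems by (metis le_SucI)
  qed
qed

end

section \<open>Ascent, essential ascent and degree of stable iteration\<close>

lemma Inf_enat_Collect: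
  "Inf {enat n |n. P n} = (if \<exists>n. P n then enat (LEAST n. P n) else \<infinity>)"
proof (cases "\<exists>n. P n")
  case True
  then have "P (LEAST n. P n)" by (metis LeastI_ex)
  then have "Inf {enat n |n. P n} = enat (LEAST n. P n)"
    by (intro antisym Inf_lower Inf_greatest) (auto intro: Least_le)
  then show ?thesis using True by simp
next
  case False
  then show ?thesis by (simp add: Inf_enat_def)
qed

context clinear_operator
begin

lemma essential_ascent_finite_iff:
  "essential_ascent T < \<infinity> \<longleftrightarrow> (\<exists>n. finite_dim (kernel T \<inter> range (T ^^ n)))"
  by (simp add: essential_ascent_def Inf_enat_Collect)

lemma essential_ascent_pow_finite_iff:
  assumes "m \<ge> 1"
  shows "essential_ascent (T ^^ m) < \<infinity> \<longleftrightarrow> essential_ascent T < \<infinity>"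
proof -
  interpret Tm: clinear_operator "T ^^ m" by (rule clinear_pow)
  show ?thesis
    unfolding essential_ascent_finite_iff Tm.essential_ascent_finite_iff funpow_mult
  proof
    assume "\<exists>n. finite_dim (kernel (T ^^ m) \<inter> range (T ^^ (m * n)))"
    then obtain n where "finite_dim (kernel (T ^^ m) \<inter> range (T ^^ (m * n)))" by blast
    moreover have "kernel T \<subseteq> kernel (T ^^ m)" using kernel_pow_mono[OF assms] by simp
    ultimately show "\<exists>n. finite_dim (kernel T \<inter> range (T ^^ n))"
      using finite_dim_csubspace_subset[OF csubspace_kernel_T_Int_range, of "m * n"] by blast
  next
    assume "\<exists>n. finite_dim (kernel T \<inter> range (T ^^ n))"
    then obtain n where "finite_dim (kernel T \<inter> range (T ^^ n))" by blast
    moreover have "n \<le> m * n" using assms by simp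
    ultimately show "\<exists>n. finite_dim (kernel (T ^^ m) \<inter> range (T ^^ (m * n)))"
      using finite_dim_kernel_pow_Int_range by blast
  qed
qed

lemma stable_from_if_finite_essential_ascent:
  assumes "essential_ascent T < \<infinity>"
  shows "\<exists>n. stable_from n"
proof -
  obtain n where n: "finite_dim (kernel T \<inter> range (T ^^ n))"
    using assms essential_ascent_finite_iff by blast
  have "kernel T \<inter> range (T ^^ j) \<subseteq> kernel T \<inter> range (T ^^ i)" if "i \<le> j" for i j
    using range_pow_antimono[OF that] by blast
  from finite_dim_chain_stabilizes[of "\<lambda>n. kernel T \<inter> range (T ^^ n)",
      OF csubspace_kernel_T_Int_range this n]
  show ?thesis unfolding stable_from_def .
qed

lemma dis_eq: "dis T = Inf {enat n |n. stable_from n}"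
proof -
  have "(\<forall>m\<ge>1. m \<ge> n \<longrightarrow> kernel T \<inter> range (T ^^ n) = kernel T \<inter> range (T ^^ m)) \<longleftrightarrow> stable_from n"
    for n
  proof
    assume *: "\<forall>m\<ge>1. m \<ge> n \<longrightarrow> kernel T \<inter> range (T ^^ n) = kernel T \<inter> range (T ^^ m)"
    have "kernel T \<inter> range (T ^^ k) = kernel T \<inter> range (T ^^ n)" if "n \<le> k" for k
    proof (cases "k = 0")
      case True
      then show ?thesis using that by simp
    next
      case False
      then have "1 \<le> k" by simp
      with * that show ?thesis by metis
    qed
    then show "stable_from n" unfolding stable_from_def by blast
  next
    assume "stable_from n"
    then show "\<forall>m\<ge>1. m \<ge> n \<longrightarrow> kernel T \<inter> range (T ^^ n) = kernel T \<inter> range (T ^^ m)"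
      unfolding stable_from_def by metis
  qed
  then show ?thesis unfolding dis_def by simp
qed

lemma range_plus_kernel_eq_range_ker: "range T + kernel (T ^^ n) = range_ker n 1"
  by (simp add: range_ker_def)

text \<open>
  Any stable \<open>n\<close> may replace \<open>dis T\<close>.  This is what allows \<open>T\<close> and \<open>T ^^ m\<close>, whose degrees of stable
  iteration differ, to be compared with the same kernel.
\<close>
lemma essentially_left_Drazin_invertible_iff:
  assumes "stable_from n"
  shows "essentially_left_Drazin_invertible T \<longleftrightarrow>
    essential_ascent T < \<infinity> \<and> topologically_complemented (range_ker n 1)"
proof -
  define d where "d = (LEAST n. stable_from n)"
  have "stable_from d" "d \<le> n" using assms by (auto simp: d_def intro: LeastI Least_le)
  then have "range_ker n 1 = range_ker d 1" by (rule range_ker_eq_if_stable)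
  moreover have "dis T = enat d" using assms by (auto simp: dis_eq Inf_enat_Collect d_def)
  ultimately show ?thesis
    by (simp add: essentially_left_Drazin_invertible_def range_plus_kernel_eq_range_ker del: One_nat_def)
qed

lemma kernel_pow_Suc_eq_iff:
  "kernel (T ^^ n) = kernel (T ^^ (n + 1)) \<longleftrightarrow> kernel T \<inter> range (T ^^ n) = {0}"
proof
  assume *: "kernel (T ^^ n) = kernel (T ^^ (n + 1))"
  have "x = 0" if "x \<in> kernel T \<inter> range (T ^^ n)" for x
  proof -
    have "T x = 0" "x \<in> range (T ^^ n)" using that by (simp_all add: kernel_def)
    then obtain y where y: "x = (T ^^ n) y" "T x = 0" by blast
    then have "y \<in> kernel (T ^^ (n + 1))" by (simp add: kernel_def)
    with * y show ?thesis by (simp add: kernel_def set_eq_iff)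
  qed
  then show "kernel T \<inter> range (T ^^ n) = {0}"
    using complex_vector.subspace_0[OF csubspace_kernel_T_Int_range] by blast
next
  assume *: "kernel T \<inter> range (T ^^ n) = {0}"
  have "y \<in> kernel (T ^^ n)" if "y \<in> kernel (T ^^ (n + 1))" for y
  proof -
    have "(T ^^ n) y \<in> kernel T \<inter> range (T ^^ n)" using that by (simp add: kernel_def)
    with * show ?thesis by (simp add: kernel_def)
  qed
  then show "kernel (T ^^ n) = kernel (T ^^ (n + 1))"
    using kernel_pow_mono[of n "n + 1"] by (intro equalityI subsetI) auto
qed

lemma ascent_eq: "ascent T = Inf {enat n |n. kernel T \<inter> range (T ^^ n) = {0}}"
  unfolding ascent_def kernel_pow_Suc_eq_iff ..

text \<open>
  The ascent is the first \<open>n\<close> with \<open>kernel T \<inter> range (T ^^ n) = {0}\<close>.  If these intersections reach \<open>{0}\<close> at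
  all, then being constant from \<open>n\<close> on is the same as being \<open>{0}\<close> at \<open>n\<close>.
\<close>
lemma dis_eq_ascent:
  assumes "ascent T < \<infinity>"
  shows "dis T = ascent T"
proof -
  obtain p where p: "kernel T \<inter> range (T ^^ p) = {0}"
    using assms by (auto simp: ascent_eq Inf_enat_Collect split: if_splits)
  have "stable_from n \<longleftrightarrow> kernel T \<inter> range (T ^^ n) = {0}" for n
  proof
    assume "stable_from n"
    then have "kernel T \<inter> range (T ^^ (n + p)) = kernel T \<inter> range (T ^^ n)"
      unfolding stable_from_def by (metis le_add1)
    moreover have "kernel T \<inter> range (T ^^ (n + p)) \<subseteq> {0}"
      using p range_pow_antimono[of p "n + p"] by auto
    ultimately show "kernel T \<inter> range (T ^^ n) = {0}"
      using complex_vector.subspace_0[OF csubspace_kernel_T_Int_range[of n]] by blast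
  next
    assume *: "kernel T \<inter> range (T ^^ n) = {0}"
    have "kernel T \<inter> range (T ^^ k) = {0}" if "n \<le> k" for k
      using * range_pow_antimono[OF that]
        complex_vector.subspace_0[OF csubspace_kernel_T_Int_range[of k]] by blast
    then show "stable_from n" using * unfolding stable_from_def by metis
  qed
  then show ?thesis by (simp add: dis_eq ascent_eq)
qed

lemma left_Drazin_invertible_iff:
  "left_Drazin_invertible T \<longleftrightarrow> ascent T < \<infinity> \<and> essentially_left_Drazin_invertible T"
proof (cases "ascent T < \<infinity>")
  case True
  then obtain p where "kernel T \<inter> range (T ^^ p) = {0}"
    by (auto simp: ascent_eq Inf_enat_Collect split: if_splits)
  then have "complex_vector.span {} = kernel T \<inter> range (T ^^ p)" by simp
  then have "essential_ascent T < \<infinity>"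
    unfolding essential_ascent_finite_iff finite_dim_def by blast
  then show ?thesis
    using True dis_eq_ascent
    by (simp add: left_Drazin_invertible_def essentially_left_Drazin_invertible_def)
next
  case False
  then show ?thesis by (auto simp: left_Drazin_invertible_def)
qed

lemma ascent_pow_finite_iff:
  assumes "m \<ge> 1"
  shows "ascent (T ^^ m) < \<infinity> \<longleftrightarrow> ascent T < \<infinity>"
proof -
  have finite_iff: "ascent S < \<infinity> \<longleftrightarrow> (\<exists>n. kernel (S ^^ n) = kernel (S ^^ (n + 1)))" for S :: "'a \<Rightarrow> 'a"
    by (simp add: ascent_def Inf_enat_Collect)
  show ?thesis
    unfolding finite_iff funpow_mult
  proof
    assume "\<exists>n. kernel (T ^^ (m * n)) = kernel (T ^^ (m * (n + 1)))"
    then obtain n where "kernel (T ^^ (m * n)) = kernel (T ^^ (m * (n + 1)))" by blast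
    moreover have "kernel (T ^^ (m * n + 1)) \<subseteq> kernel (T ^^ (m * (n + 1)))"
      using assms by (intro kernel_pow_mono) simp
    ultimately have "kernel (T ^^ (m * n)) = kernel (T ^^ (m * n + 1))"
      using kernel_pow_mono[of "m * n" "m * n + 1"] by auto
    then show "\<exists>n. kernel (T ^^ n) = kernel (T ^^ (n + 1))" by blast
  next
    assume "\<exists>n. kernel (T ^^ n) = kernel (T ^^ (n + 1))"
    then obtain n where n: "kernel T \<inter> range (T ^^ n) = {0}"
      using kernel_pow_Suc_eq_iff by blast
    have eq: "kernel (T ^^ k) = kernel (T ^^ n)" if "n \<le> k" for k
      using that
    proof (induction k rule: dec_induct)
      case (step k)
      have "kernel T \<inter> range (T ^^ k) = {0}"
        using n range_pow_antimono[OF step.hyps(1)]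
          complex_vector.subspace_0[OF csubspace_kernel_T_Int_range[of k]] by blast
      then have "kernel (T ^^ k) = kernel (T ^^ Suc k)"
        using kernel_pow_Suc_eq_iff[of k] by (metis Suc_eq_plus1)
      then show ?case using step.IH by metis
    qed simp
    have "n \<le> m * n" "n \<le> m * (n + 1)" using assms by (auto simp: trans_le_add2)
    then show "\<exists>n. kernel (T ^^ (m * n)) = kernel (T ^^ (m * (n + 1)))"
      using eq by metis
  qed
qed

end

section \<open>Powers of Drazin invertible operators\<close>

context bounded_clinear_operator
begin

lemma essentially_left_Drazin_invertible_pow_iff:
  assumes m: "m \<ge> 1"
  shows "essentially_left_Drazin_invertible (T ^^ m) \<longleftrightarrow> essentially_left_Drazin_invertible T"
proof (cases "essential_ascent T < \<infinity>")
  case False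
  then show ?thesis
    using essential_ascent_pow_finite_iff[OF m] unfolding essentially_left_Drazin_invertible_def
    by blast
next
  case True
  interpret Tm: clinear_operator "T ^^ m" by (rule clinear_pow)
  obtain d where d: "stable_from d"
    using True stable_from_if_finite_essential_ascent by blast
  have "essential_ascent (T ^^ m) < \<infinity>" using True essential_ascent_pow_finite_iff[OF m] by blast
  then obtain e where e: "Tm.stable_from e"
    using Tm.stable_from_if_finite_essential_ascent by blast
  \<comment> \<open>A multiple \<open>m * k\<close> with \<open>m * k\<close> stable for \<open>T\<close> and \<open>k\<close> stable for \<open>T ^^ m\<close>.\<close>
  define n where "n = m * (d + e)"
  have "d + e \<le> n" using mult_le_mono1[OF m, of "d + e"] by (simp add: n_def)
  then have "d \<le> n" by simp
  then have n: "stable_from n" by (rule stable_from_mono[OF d])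
  have "Tm.stable_from (d + e)" using Tm.stable_from_mono[OF e] by simp
  moreover have "Tm.range_ker (d + e) 1 = range_ker n m"
    by (simp add: Tm.range_ker_def range_ker_def funpow_mult n_def)
  ultimately have "essentially_left_Drazin_invertible (T ^^ m) \<longleftrightarrow>
      essential_ascent (T ^^ m) < \<infinity> \<and> topologically_complemented (range_ker n m)"
    using Tm.essentially_left_Drazin_invertible_iff by metis
  moreover have "topologically_complemented (range_ker n m) \<longleftrightarrow> topologically_complemented (range_ker n 1)"
  proof
    obtain j where "m = Suc j" using m by (cases m) auto
    then show "topologically_complemented (range_ker n m) \<Longrightarrow> topologically_complemented (range_ker n 1)"
      using topologically_complemented_range_ker_one[OF n] by blast
  qed (rule topologically_complemented_range_ker_pow[OF n])
  ultimately show ?thesis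
    using essentially_left_Drazin_invertible_iff[OF n] essential_ascent_pow_finite_iff[OF m]
    by blast
qed

lemma left_Drazin_invertible_pow_iff:
  assumes m: "m \<ge> 1"
  shows "left_Drazin_invertible (T ^^ m) \<longleftrightarrow> left_Drazin_invertible T"
  using left_Drazin_invertible_iff ascent_pow_finite_iff[OF m]
    clinear_operator.left_Drazin_invertible_iff[OF clinear_pow, of m]
    essentially_left_Drazin_invertible_pow_iff[OF m]
  by blast

end

theorem theorem4p1:
  fixes T :: "'a::complex_banach \<Rightarrow> 'a"
  assumes "\<not> finite_dim (UNIV :: 'a set)"
    and "bounded_clinear T"
  shows "((left_Drazin_invertible T \<longleftrightarrow> (\<forall>m\<ge>1. left_Drazin_invertible (T ^^ m))) \<and>
          (left_Drazin_invertible T \<longleftrightarrow> (\<exists>m\<ge>1. left_Drazin_invertible (T ^^ m)))) \<and>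
         ((essentially_left_Drazin_invertible T \<longleftrightarrow>
            (\<forall>m\<ge>1. essentially_left_Drazin_invertible (T ^^ m))) \<and>
          (essentially_left_Drazin_invertible T \<longleftrightarrow>
            (\<exists>m\<ge>1. essentially_left_Drazin_invertible (T ^^ m))))"
proof -
  interpret bounded_clinear_operator T by standard (rule assms(2))
  show ?thesis
    using left_Drazin_invertible_pow_iff essentially_left_Drazin_invertible_pow_iff
    by (meson order_refl)
qed

end
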